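(* Let $G$ be a tree of cycles of girth $g$. Then $$G\in \mathrm{FCH}\Bigl(2+\Bigl\lfloor \frac{g}{2}\Bigr\rfloor^{-1}\Bigr).$$
   Context: Graphs are finite and simple. A tree of cycles is a graph $G$ such that all its cycles are pairwise (vertex-)disjoint and collapsing all vertices of each cycle of $G$ (i.e. contracting each cycle to a single vertex) produces a tree. The girth $g$ is the length of a shortest cycle of $G$ (so $G$ contains at least one cycle). Throughout, $a\ge b\ge 1$ are integers. A color-list $L$ of a graph $G$ is an assignment of lists (finite sets) of integers, called colors, to the vertices of $G$; an $a$-color-list is a color-list with $|L(v)|=a$ for every $v\in V(G)$. An $(L,b)$-coloring of $G$ is a mapping $c$ associating to each vertex $u$ a subset $c(u)\subseteq L(u)$ with $|c(u)|=b$ such that $c(u)\cap c(v)=\emptyset$ for every edge $uv\in E(G)$. The graph $G$ is free $(a,b)$-choosable if for every $a$-color-list $L$ of $G$, every vertex $v\in V(G)$ and every set $c_0\subseteq L(v)$ of $b$ colors, there exists an $(L,b)$-coloring $c$ of $G$ such that $c(v)=c_0$. For a real $x$, $\mathrm{FCH}(x)$ is the set of graphs $G$ that are free $(a,b)$-choosable for all integers $a\ge b\ge 1$ with $\frac{a}{b}\ge x$. $\lfloor x\rfloor$ is the greatest integer at most $x$. *)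

theory Defs
  imports Complex_Main "HOL-Library.Extended_Nat" "Graph_Theory.Graph_Theory"
begin

text \<open>
  Finite simple graphs are the symmetric loop-free finite digraphs of the locale
  \<^locale>\<open>pair_graph\<close>: an undirected edge is a pair of opposite arcs.  Hence the library's
  notion of a cycle also covers the closed walk u, v, u along a single edge, and the library's
  \<^const>\<open>tree\<close> and \<^const>\<open>forest\<close>, which exclude those walks too, are not the undirected notions.
  A cycle of an undirected graph is a cycle in the library sense with at least three arcs.
\<close>

definition graph_cycle :: "'a pair_pre_digraph \<Rightarrow> ('a \<times> 'a) awalk \<Rightarrow> bool" where
  "graph_cycle G p \<longleftrightarrow> pre_digraph.cycle (with_proj G) p \<and> 3 \<le> length p"

text \<open>Every vertex of a closed walk is the tail of one of its arcs.\<close>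

definition cycle_verts :: "('a \<times> 'a) awalk \<Rightarrow> 'a set" where
  "cycle_verts p = fst ` set p"

text \<open>
  Walks that differ only in starting point or orientation traverse the same cycle of the graph,
  so cycles are identified by their sets of undirected edges.
\<close>

definition cycle_edges :: "('a \<times> 'a) awalk \<Rightarrow> ('a \<times> 'a) set" where
  "cycle_edges p = set p \<union> (set p)\<inverse>"

definition disjoint_cycles :: "'a pair_pre_digraph \<Rightarrow> bool" where
  "disjoint_cycles G \<longleftrightarrow>
    (\<forall>p q. graph_cycle G p \<and> graph_cycle G q \<and> cycle_edges p \<noteq> cycle_edges q
      \<longrightarrow> cycle_verts p \<inter> cycle_verts q = {})"

definition undirected_tree :: "'a pair_pre_digraph \<Rightarrow> bool" where
  "undirected_tree G \<longleftrightarrow>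
    pair_graph G \<and> Digraph_Component.connected (with_proj G) \<and> (\<nexists>p. graph_cycle G p)"

text \<open>
  The vertex to which \<open>v\<close> is collapsed is represented by the set of all vertices collapsed
  together with \<open>v\<close>.  If the cycles are pairwise disjoint, these sets partition the vertices:
  they are the vertex sets of the cycles and the singletons of vertices on no cycle.
\<close>

definition cycle_class :: "'a pair_pre_digraph \<Rightarrow> 'a \<Rightarrow> 'a set" where
  "cycle_class G v = insert v (\<Union> {cycle_verts p | p. graph_cycle G p \<and> v \<in> cycle_verts p})"

text \<open>
  The contraction is taken as a simple graph: loops are dropped and parallel edges identified.
  With pairwise disjoint cycles this loses nothing except the edges of the contracted cycles,
  as a chord of a cycle, or two edges between the same two classes, would give rise to a further
  cycle meeting an existing one.
\<close>

definition contract_cycles :: "'a pair_pre_digraph \<Rightarrow> 'a set pair_pre_digraph" where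
  "contract_cycles G =
    \<lparr> pverts = cycle_class G ` pverts G,
      parcs = {(cycle_class G u, cycle_class G v) | u v.
                 (u, v) \<in> parcs G \<and> cycle_class G u \<noteq> cycle_class G v} \<rparr>"

definition tree_of_cycles :: "'a pair_pre_digraph \<Rightarrow> bool" where
  "tree_of_cycles G \<longleftrightarrow>
    pair_graph G \<and> disjoint_cycles G \<and> undirected_tree (contract_cycles G)"

text \<open>The girth is infinite iff there is no cycle.\<close>

definition girth :: "'a pair_pre_digraph \<Rightarrow> enat" where
  "girth G = (INF p\<in>{p. graph_cycle G p}. enat (length p))"

text \<open>
  List assignments and colorings are total functions; only their values on the vertices of the
  graph matter.
\<close>

definition color_list :: "'a pair_pre_digraph \<Rightarrow> nat \<Rightarrow> ('a \<Rightarrow> int set) \<Rightarrow> bool" where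
  "color_list G a L \<longleftrightarrow> (\<forall>v\<in>pverts G. finite (L v) \<and> card (L v) = a)"

definition list_coloring ::
    "'a pair_pre_digraph \<Rightarrow> ('a \<Rightarrow> int set) \<Rightarrow> nat \<Rightarrow> ('a \<Rightarrow> int set) \<Rightarrow> bool" where
  "list_coloring G L b c \<longleftrightarrow>
    (\<forall>u\<in>pverts G. c u \<subseteq> L u \<and> card (c u) = b) \<and>
    (\<forall>(u, v)\<in>parcs G. c u \<inter> c v = {})"

definition free_choosable :: "nat \<Rightarrow> nat \<Rightarrow> 'a pair_pre_digraph \<Rightarrow> bool" where
  "free_choosable a b G \<longleftrightarrow>
    (\<forall>L v c\<^sub>0. color_list G a L \<and> v \<in> pverts G \<and> c\<^sub>0 \<subseteq> L v \<and> card c\<^sub>0 = b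
      \<longrightarrow> (\<exists>c. list_coloring G L b c \<and> c v = c\<^sub>0))"

definition FCH :: "real \<Rightarrow> 'a pair_pre_digraph set" where
  "FCH x = {G. pair_graph G \<and>
    (\<forall>a b. 1 \<le> b \<and> b \<le> a \<and> x \<le> real a / real b \<longrightarrow> free_choosable a b G)}"

end

(* Put e = a - 2b.  Along a path with a precolored vertex number 0, a color set T at vertex number
   i >= 1 can be reached as soon as T meets a certain set C of b or a - b colors in at most
   floor(i/2) * e elements: for i = 1 this C is the color set of vertex 0, and it is then replaced
   by a - |C| colors of the list of vertex i outside C.  A path of length n whose two ends are both precolored
   can therefore be colored if floor(n/2) * e >= b; this applies to a cycle with one precolored
   vertex.

   The graph is colored by enlarging a colored vertex set S that never has a path through its
   complement joining two distinct vertices of S.  If some cycle meets S in exactly one vertex, it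
   is added as a whole: since cycles are disjoint, it has no chords or ears, so no other edges
   towards S arise.  Otherwise a single vertex with at most one neighbour in S is added. *)
theory Submission
  imports Defs
begin

section \<open>Colouring a path between prescribed colour sets\<close>

text \<open>\<open>X\<close> and \<open>T\<close> sit just before and just after the path and are
  tied to no list, so they may coincide when the path closes up to a cycle.\<close>

definition path_colorable :: "('a \<Rightarrow> 'c set) \<Rightarrow> nat \<Rightarrow> 'c set \<Rightarrow> 'a list \<Rightarrow> 'c set \<Rightarrow> bool" where
  "path_colorable L b X us T \<longleftrightarrow> (\<exists>c. (\<forall>u\<in>set us. c u \<subseteq> L u \<and> card (c u) = b) \<and>
    successively (\<lambda>A B. A \<inter> B = {}) (X # map c us @ [T]))"

text \<open>Induction from the far end: a new vertex \<open>u\<close> reserves a set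
  \<open>D\<close> of colours outside the old \<open>C\<close>. Facing \<open>T\<close>, it uses
  colours of \<open>D - T\<close> first, as these are harmless for the part already treated; only
  the shortage is filled from outside \<open>D\<close>, and only that part can meet
  \<open>C\<close>.\<close>

lemma path_coloring:
  fixes L :: "'a \<Rightarrow> 'c set" and X :: "'c set"
  assumes "2 * b \<le> a" "finite X" "card X = b"
    and "distinct us" "\<And>u. u \<in> set us \<Longrightarrow> finite (L u) \<and> card (L u) = a"
  shows "\<exists>C. finite C \<and> card C = (if even (length us) then b else a - b) \<and>
    (\<forall>T. finite T \<and> card T = b \<and> card (T \<inter> C) \<le> Suc (length us) div 2 * (a - 2 * b) \<longrightarrow> path_colorable L b X us T)"
  using assms(4,5)
proof (induction us rule: rev_induct)
  case Nil
  show ?case using assms by (intro exI[of _ X]) (auto simp: Int_commute path_colorable_def)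
next
  case (snoc u us)
  define e where "e = a - 2 * b"
  define t where "t = Suc (length us) div 2 * e"
  have "distinct us" "\<And>w. w \<in> set us \<Longrightarrow> finite (L w) \<and> card (L w) = a"
    using snoc.prems by auto
  from snoc.IH[OF this] obtain C where C: "finite C" "card C = (if even (length us) then b else a - b)"
    and ext: "\<And>T. finite T \<Longrightarrow> card T = b \<Longrightarrow> card (T \<inter> C) \<le> t \<Longrightarrow> path_colorable L b X us T"
    unfolding t_def e_def by blast
  have L: "finite (L u)" "card (L u) = a" using snoc.prems by auto
  have "card (L u - C) \<ge> a - card C"
    using C(1) L by (metis diff_card_le_card_Diff)
  then obtain D where D: "D \<subseteq> L u - C" "card D = a - card C" "finite D"
    by (meson obtain_subset_with_card_n)
  have cardC: "card C \<le> a" using C(2) assms(1) by auto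
  show ?case
  proof (intro exI[of _ D] conjI allI impI)
    show "finite D" by fact
    show "card D = (if even (length (us @ [u])) then b else a - b)"
      using D(2) C(2) assms(1) by auto
    fix T assume T: "finite T \<and> card T = b \<and>
      card (T \<inter> D) \<le> Suc (length (us @ [u])) div 2 * (a - 2 * b)"
    define d where "d = card (T \<inter> D)"
    \<comment> \<open>Both parities give one bound: either \<open>card C = b\<close> and the
      allowance for \<open>d\<close> has just grown by \<open>e\<close>, or
      \<open>card C = b + e\<close> and the allowance is still \<open>t\<close>.\<close>
    have d: "card C + d \<le> t + e + b"
    proof (cases "even (length us)")
      case True
      then show ?thesis using T C(2) unfolding d_def t_def e_def by (auto simp: algebra_simps)
    next
      case False
      then have "Suc (length (us @ [u])) div 2 = Suc (length us) div 2" by auto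
      then have "d \<le> t" using T unfolding d_def t_def e_def by metis
      then show ?thesis using False C(2) assms(1) unfolding e_def by auto
    qed
    have dD: "card (D - T) = a - card C - d"
      unfolding d_def using D by (metis Int_commute card_Diff_subset_Int finite_Int)
    have "card (T - D) = b - d"
      using T unfolding d_def by (metis card_Diff_subset_Int finite_Int)
    moreover have "card (L u - D) = card C"
      using D L cardC by (subst card_Diff_subset) auto
    moreover have "card (L u - D) - card (T - D) \<le> card (L u - D - (T - D))"
      using T by (intro diff_card_le_card_Diff) auto
    moreover have "L u - D - (T - D) = L u - D - T" by blast
    ultimately have dR: "card C - (b - d) \<le> card (L u - D - T)" by simp
    have d_le: "d \<le> b" unfolding d_def using T by (metis Int_lower1 card_mono)
    obtain S where S: "S \<subseteq> L u" "S \<inter> T = {}" "card S = b" "card (S \<inter> C) \<le> t"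
    proof (cases "b \<le> card (D - T)")
      case True
      then obtain S where "S \<subseteq> D - T" "card S = b" by (meson obtain_subset_with_card_n)
      moreover from this have "S \<inter> C = {}" using D by auto
      ultimately show ?thesis using D by (intro that[of S]) auto
    next
      case False
      then have lt: "a - card C - d < b" using dD by simp
      \<comment> \<open>Outside \<open>D\<close> there are \<open>card C\<close> colours of
        \<open>L u\<close>, and \<open>T\<close> blocks at most \<open>b - d\<close> of them; the
        rest covers the shortage because \<open>2 * b \<le> a\<close>.\<close>
      have "b - (a - card C - d) \<le> card (L u - D - T)"
        using dR lt d_le cardC assms(1) C(2) by (auto split: if_splits)
      then obtain R where R: "R \<subseteq> L u - D - T" "card R = b - (a - card C - d)" "finite R"
        by (meson obtain_subset_with_card_n)
      show ?thesis
      proof (rule that[of "(D - T) \<union> R"])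
        show "(D - T) \<union> R \<subseteq> L u" "((D - T) \<union> R) \<inter> T = {}" using D R by auto
        have "card ((D - T) \<union> R) = card (D - T) + card R"
          using D R by (intro card_Un_disjoint) auto
        then show "card ((D - T) \<union> R) = b" using R dD lt by simp
        have "card (((D - T) \<union> R) \<inter> C) \<le> card R"
          using D R by (intro card_mono) auto
        \<comment> \<open>With \<open>a = 2 * b + e\<close> the shortage is
          \<open>card C + d - b - e\<close>, which is exactly what \<open>d\<close> bounds by
          \<open>t\<close>.\<close>
        also have "\<dots> \<le> t" using R d cardC lt assms(1) unfolding e_def by auto
        finally show "card (((D - T) \<union> R) \<inter> C) \<le> t" .
      qed
    qed
    obtain c where c: "\<forall>u\<in>set us. c u \<subseteq> L u \<and> card (c u) = b"
      "successively (\<lambda>A B. A \<inter> B = {}) (X # map c us @ [S])"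
      using ext[of S] S L finite_subset[of S "L u"] unfolding path_colorable_def by blast
    have "u \<notin> set us" using snoc.prems by simp
    then have m: "map (c(u := S)) (us @ [u]) = map c us @ [S]" by auto
    show "path_colorable L b X (us @ [u]) T"
      unfolding path_colorable_def
    proof (intro exI[of _ "c(u := S)"] conjI ballI)
      fix w assume "w \<in> set (us @ [u])"
      then show "(c(u := S)) w \<subseteq> L w" "card ((c(u := S)) w) = b" using c(1) S by auto
    next
      have "successively (\<lambda>A B. A \<inter> B = {}) ((X # map c us @ [S]) @ [T])"
        using c(2) S(2) by (subst successively_append_iff) auto
      then show "successively (\<lambda>A B. A \<inter> B = {}) (X # map (c(u := S)) (us @ [u]) @ [T])"
        unfolding m by simp
    qed
  qed
qed

section \<open>Paths and cycles as vertex lists\<close>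

fun steps :: "'a list \<Rightarrow> 'a rel" where
  "steps (x # y # zs) = insert (x, y) (steps (y # zs))"
| "steps _ = {}"

lemma steps_append: "steps (xs @ y # ys) = steps (xs @ [y]) \<union> steps (y # ys)"
  by (induction xs rule: steps.induct) auto

lemma steps_rev: "steps (rev xs) = (steps xs)\<inverse>"
proof (induction xs rule: steps.induct)
  case (1 x y zs)
  then show ?case using steps_append[of "rev zs" y "[x]"] by auto
qed auto

lemma steps_subset: "steps xs \<subseteq> set xs \<times> set xs"
  by (induction xs rule: steps.induct) auto

lemma steps_map: "successively P (map f xs) \<Longrightarrow> (x, y) \<in> steps xs \<Longrightarrow> P (f x) (f y)"
  by (induction xs rule: steps.induct) auto

text \<open>The start is not repeated in \<open>xs\<close>; appending \<open>hd xs\<close> supplies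
  the closing arc. Vertex lists are easy to split, rotate and reverse.\<close>

definition vertex_cycle :: "'a rel \<Rightarrow> 'a list \<Rightarrow> bool" where
  "vertex_cycle E xs \<longleftrightarrow> distinct xs \<and> 3 \<le> length xs \<and> steps (xs @ [hd xs]) \<subseteq> E"

definition vertex_cycle_edges :: "'a list \<Rightarrow> 'a rel" where
  "vertex_cycle_edges xs = steps (xs @ [hd xs]) \<union> (steps (xs @ [hd xs]))\<inverse>"

text \<open>Allows a cycle to be read from any of its vertices.\<close>

lemma steps_rotate: "steps ((as @ x # bs) @ [hd (as @ x # bs)]) = steps ((x # bs @ as) @ [x])"
proof (cases as)
  case (Cons p as')
  have "steps ((p # as') @ x # bs @ [p]) = steps (p # as' @ [x]) \<union> steps (x # bs @ [p])"
    using steps_append[of "p # as'" x "bs @ [p]"] by simp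
  moreover have "steps ((x # bs) @ p # as' @ [x]) = steps (x # bs @ [p]) \<union> steps (p # as' @ [x])"
    using steps_append[of "x # bs" p "as' @ [x]"] by simp
  ultimately show ?thesis using Cons by auto
qed simp

lemma vertex_cycle_edges_subset: "vertex_cycle_edges xs \<subseteq> set xs \<times> set xs"
proof (cases xs)
  case (Cons x ys)
  then show ?thesis using steps_subset[of "xs @ [hd xs]"] unfolding vertex_cycle_edges_def by auto
qed (simp add: vertex_cycle_edges_def)

text \<open>Edges inside \<open>S\<close> are allowed, hence \<open>zs \<noteq> []\<close>. Cycles
  leaving \<open>S\<close> and returning to the same vertex are allowed as well, hence
  \<open>x \<noteq> y\<close>; these are the cycles to be added.\<close>

definition separated :: "'a rel \<Rightarrow> 'a set \<Rightarrow> bool" where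
  "separated E S \<longleftrightarrow> (\<forall>x\<in>S. \<forall>y\<in>S. \<forall>zs. x \<noteq> y \<and> zs \<noteq> [] \<and> distinct zs \<and> set zs \<inter> S = {} \<longrightarrow>
    \<not> steps (x # zs @ [y]) \<subseteq> E)"

section \<open>Structure of graphs with disjoint cycles\<close>

locale disjoint_vertex_cycles =
  fixes E :: "'a rel"
  assumes sym: "sym E" and irrefl: "irrefl E"
    and cycles: "\<And>xs ys. vertex_cycle E xs \<Longrightarrow> vertex_cycle E ys \<Longrightarrow> set xs \<inter> set ys \<noteq> {} \<Longrightarrow>
      vertex_cycle_edges xs = vertex_cycle_edges ys"
begin

lemma steps_rev_subset: "steps xs \<subseteq> E \<Longrightarrow> steps (rev xs) \<subseteq> E"
  using sym by (auto simp: steps_rev sym_def)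

text \<open>An arc of the cycle from \<open>x\<close> to \<open>y\<close>, closed up by the ear,
  would be a second cycle through \<open>x\<close>, so it must have the same edges as the
  first.\<close>

lemma no_ear:
  assumes cyc: "vertex_cycle E xs" and x: "x \<in> set xs" and y: "y \<in> set xs" and "x \<noteq> y"
    and zs: "distinct zs" "set zs \<inter> set xs = {}" "steps (x # zs @ [y]) \<subseteq> E"
  shows "zs = [] \<and> (x, y) \<in> vertex_cycle_edges xs"
proof -
  obtain as0 bs0 where xs: "xs = as0 @ x # bs0" using x by (meson split_list)
  then have "y \<in> set (bs0 @ as0)" using y \<open>x \<noteq> y\<close> by auto
  then obtain as bs where ab: "bs0 @ as0 = as @ y # bs" by (meson split_list)
  define xs' where "xs' = x # as @ y # bs"
  have st: "steps (xs @ [hd xs]) = steps (xs' @ [x])"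
    using steps_rotate[of as0 x bs0] unfolding xs xs'_def using ab by simp
  have "mset xs = mset xs'" using arg_cong[OF ab, of mset] unfolding xs xs'_def by (simp add: union_commute)
  then have set: "set xs' = set xs" and dist: "distinct xs'"
    using cyc unfolding vertex_cycle_def by (metis mset_eq_setD, metis mset_eq_imp_distinct_iff)
  have sub: "steps (xs' @ [x]) \<subseteq> E" using cyc st unfolding vertex_cycle_def by simp
  have split: "steps (xs' @ [x]) = steps (x # as @ [y]) \<union> steps (y # bs @ [x])"
    unfolding xs'_def using steps_append[of "x # as" y "bs @ [x]"] by simp
  define ys where "ys = x # as @ y # rev zs"
  have stys: "steps (ys @ [hd ys]) = steps (x # as @ [y]) \<union> (steps (x # zs @ [y]))\<inverse>"
    unfolding ys_def using steps_append[of "x # as" y "rev zs @ [x]"] steps_rev[of "x # zs @ [y]"] by simp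
  show ?thesis
  \<comment> \<open>In the excluded case \<open>ys\<close> is only the edge between \<open>x\<close>
    and \<open>y\<close> run back and forth, and that edge already lies on the cycle.\<close>
  proof (cases "zs = [] \<and> as = []")
    case True
    then show ?thesis using st split unfolding vertex_cycle_edges_def by auto
  next
    case False
    have "3 \<le> length ys" using False unfolding ys_def by (cases as; cases zs) auto
    moreover have "distinct ys" using dist zs set unfolding ys_def xs'_def by auto
    moreover have "steps (ys @ [hd ys]) \<subseteq> E"
      unfolding stys using sub split zs(3) sym by (auto simp: sym_def)
    ultimately have "vertex_cycle E ys" unfolding vertex_cycle_def by simp
    moreover have "x \<in> set xs \<inter> set ys" using x unfolding ys_def by simp
    ultimately have eq: "vertex_cycle_edges xs = vertex_cycle_edges ys" using cycles[OF cyc] by blast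
    \<comment> \<open>The first edge of the ear lies on \<open>ys\<close>, hence on
      \<open>xs\<close>. Its end is then a vertex of \<open>xs\<close>, which no vertex of
      \<open>zs\<close> is, so \<open>zs\<close> is empty.\<close>
    have "(x, hd (zs @ [y])) \<in> vertex_cycle_edges ys"
      unfolding vertex_cycle_edges_def stys by (cases zs) auto
    then have mem: "(x, hd (zs @ [y])) \<in> vertex_cycle_edges xs" using eq by simp
    show ?thesis
    proof (cases zs)
      case (Cons z zs')
      then show ?thesis using mem vertex_cycle_edges_subset[of xs] zs(2) by auto
    qed (use mem in auto)
  qed
qed

lemma separated_add_cycle:
  assumes sep: "separated E S" and "s \<in> S" and cyc: "vertex_cycle E (s # us)" and us: "set us \<inter> S = {}"
  shows "separated E (S \<union> set us)"
    and "\<And>x y. x \<in> set us \<Longrightarrow> y \<in> S \<union> set us \<Longrightarrow> (x, y) \<in> E \<Longrightarrow> (x, y) \<in> vertex_cycle_edges (s # us)"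
proof -
  \<comment> \<open>A path leaving the new cycle at \<open>x\<close> can only return to that cycle:
    otherwise, preceded by the stretch of the cycle from \<open>s\<close> to \<open>x\<close>, it
    would join two vertices of \<open>S\<close> outside \<open>S\<close>. The case
    \<open>zs = []\<close> covers single edges.\<close>
  have attach: "y \<in> insert s (set us)"
    if "x \<in> set us" "y \<in> S \<union> set us" "distinct zs" "set zs \<inter> (S \<union> set us) = {}"
      "steps (x # zs @ [y]) \<subseteq> E" for x y zs
  proof (rule ccontr)
    assume "y \<notin> insert s (set us)"
    then have y: "y \<in> S" "y \<noteq> s" using that by auto
    obtain as bs where ab: "us = as @ x # bs" using split_list[OF \<open>x \<in> set us\<close>] by blast
    have "steps (s # (as @ [x])) \<subseteq> E"
      using cyc steps_append[of "s # as" x "bs @ [s]"] unfolding vertex_cycle_def ab by simp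
    then have "steps (s # (as @ x # zs) @ [y]) \<subseteq> E"
      using that(5) steps_append[of "s # as" x "zs @ [y]"] by simp
    moreover have "distinct (as @ x # zs)" "set (as @ x # zs) \<inter> S = {}"
      using cyc that us unfolding vertex_cycle_def ab by auto
    ultimately show False using sep y \<open>s \<in> S\<close> unfolding separated_def
      by (metis append_is_Nil_conv list.distinct(1))
  qed
  show "(x, y) \<in> vertex_cycle_edges (s # us)"
    if "x \<in> set us" "y \<in> S \<union> set us" "(x, y) \<in> E" for x y
  proof -
    have "y \<in> set (s # us)" using attach[of x y "[]"] that by auto
    moreover have "x \<noteq> y" using that irrefl by (auto simp: irrefl_def)
    ultimately show ?thesis using no_ear[OF cyc, of x y "[]"] that by auto
  qed
  show "separated E (S \<union> set us)"
    unfolding separated_def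
  proof (intro ballI allI impI notI)
    fix x y zs
    assume xy: "x \<in> S \<union> set us" "y \<in> S \<union> set us"
      and zs: "x \<noteq> y \<and> zs \<noteq> [] \<and> distinct zs \<and> set zs \<inter> (S \<union> set us) = {}"
      and st: "steps (x # zs @ [y]) \<subseteq> E"
    have st': "steps (y # rev zs @ [x]) \<subseteq> E" using steps_rev_subset[OF st] by simp
    have "x \<in> set us \<or> y \<in> set us"
      using sep xy zs st unfolding separated_def by blast
    \<comment> \<open>At least one end is new, and \<open>attach\<close> puts the other on the cycle
      too; the path is then an ear.\<close>
    then have "x \<in> set (s # us)" "y \<in> set (s # us)"
      using attach[of x y zs] attach[of y x "rev zs"] xy zs st st' by auto
    then show False using no_ear[OF cyc, of x y zs] zs st \<open>s \<in> S\<close> by auto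
  qed
qed

section \<open>Extending partial colourings\<close>

definition partial_coloring :: "'a set \<Rightarrow> ('a \<Rightarrow> 'c set) \<Rightarrow> nat \<Rightarrow> ('a \<Rightarrow> 'c set) \<Rightarrow> bool" where
  "partial_coloring S L b c \<longleftrightarrow> (\<forall>u\<in>S. c u \<subseteq> L u \<and> card (c u) = b) \<and>
    (\<forall>u\<in>S. \<forall>v\<in>S. (u, v) \<in> E \<longrightarrow> c u \<inter> c v = {})"

text \<open>Cut open at \<open>s\<close>, the cycle becomes the path \<open>us\<close> with
  \<open>c s\<close> prescribed at both ends. Even if all \<open>b\<close> colours of
  \<open>c s\<close> lie in \<open>C\<close>, \<open>long\<close> suffices, since
  \<open>Suc (length us)\<close> is the length of the cycle.\<close>

lemma extend_coloring_cycle: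
  fixes L c :: "'a \<Rightarrow> 'c set"
  assumes ab: "2 * b \<le> a" and L: "\<And>u. u \<in> S \<union> set us \<Longrightarrow> finite (L u) \<and> card (L u) = a"
    and sep: "separated E S" and "s \<in> S" and cyc: "vertex_cycle E (s # us)" and us: "set us \<inter> S = {}"
    and long: "b \<le> length (s # us) div 2 * (a - 2 * b)"
    and c: "partial_coloring S L b c"
  shows "\<exists>c'. partial_coloring (S \<union> set us) L b c' \<and> (\<forall>u\<in>S. c' u = c u)"
proof -
  have X: "finite (c s)" "card (c s) = b" "c s \<subseteq> L s"
    using c L \<open>s \<in> S\<close> unfolding partial_coloring_def by (auto intro: finite_subset)
  have "distinct us" using cyc unfolding vertex_cycle_def by simp
  from path_coloring[OF ab X(1,2) this, of L] L obtain C where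
    C: "finite C" "\<And>T. finite T \<Longrightarrow> card T = b \<Longrightarrow> card (T \<inter> C) \<le> Suc (length us) div 2 * (a - 2 * b) \<Longrightarrow> path_colorable L b (c s) us T" by blast
  have "card (c s \<inter> C) \<le> b" using X by (metis Int_lower1 card_mono)
  then obtain d where d: "\<And>u. u \<in> set us \<Longrightarrow> d u \<subseteq> L u \<and> card (d u) = b"
    "successively (\<lambda>A B. A \<inter> B = {}) (c s # map d us @ [c s])"
    using C(2)[OF X(1,2)] long unfolding path_colorable_def by auto
  define c' where "c' u = (if u \<in> set us then d u else c u)" for u
  have "s \<notin> set us" using cyc unfolding vertex_cycle_def by simp
  then have "map c' ((s # us) @ [hd (s # us)]) = c s # map d us @ [c s]"
    unfolding c'_def by auto
  with d(2) have "successively (\<lambda>A B. A \<inter> B = {}) (map c' ((s # us) @ [hd (s # us)]))"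
    by (simp only:)
  then have "c' x \<inter> c' y = {}" if "(x, y) \<in> steps ((s # us) @ [hd (s # us)])" for x y
    using that by (rule steps_map)
  then have disj: "c' x \<inter> c' y = {}" if "(x, y) \<in> vertex_cycle_edges (s # us)" for x y
    using that unfolding vertex_cycle_edges_def by (auto simp: Int_commute)
  \<comment> \<open>Every edge from a new vertex into the enlarged set is an edge of the cycle, so
    colouring along the path settles all of them.\<close>
  have edge: "c' x \<inter> c' y = {}" if "x \<in> set us" "y \<in> S \<union> set us" "(x, y) \<in> E" for x y
    using disj separated_add_cycle(2)[OF sep \<open>s \<in> S\<close> cyc us that] .
  have "partial_coloring (S \<union> set us) L b c'"
    unfolding partial_coloring_def
  proof (intro conjI ballI impI)
    fix u assume "u \<in> S \<union> set us"
    then show "c' u \<subseteq> L u" "card (c' u) = b"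
      using d(1) c unfolding c'_def partial_coloring_def by auto
  next
    fix u v assume uv: "u \<in> S \<union> set us" "v \<in> S \<union> set us" "(u, v) \<in> E"
    then have vu: "(v, u) \<in> E" using sym by (auto simp: sym_def)
    consider "u \<in> set us" | "v \<in> set us" | "u \<in> S" "v \<in> S" "u \<notin> set us" "v \<notin> set us" using uv by auto
    then show "c' u \<inter> c' v = {}"
    proof cases
      case 1
      then show ?thesis using edge uv by blast
    next
      case 2
      then show ?thesis using edge[of v u] uv vu by blast
    next
      case 3
      then show ?thesis using c uv unfolding c'_def partial_coloring_def by auto
    qed
  qed
  moreover have "\<forall>u\<in>S. c' u = c u" using us unfolding c'_def by auto
  ultimately show ?thesis by blast
qed

text \<open>Separation leaves \<open>u\<close> at most one neighbour in \<open>S\<close>, which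
  blocks only \<open>b\<close> of at least \<open>2 * b\<close> colours. The second alternative of
  \<open>adj\<close> covers the situation where no edge leaves \<open>S\<close>.\<close>

lemma extend_coloring_vertex:
  fixes L c :: "'a \<Rightarrow> 'c set"
  assumes ab: "2 * b \<le> a" and L: "finite (L u)" "card (L u) = a" "\<And>v. v \<in> S \<Longrightarrow> finite (L v)"
    and "u \<notin> S"
    and sep: "separated E S"
    and nocyc: "\<And>s us. s \<in> S \<Longrightarrow> set us \<inter> S = {} \<Longrightarrow> \<not> vertex_cycle E (s # us)"
    and adj: "(\<exists>s\<in>S. (s, u) \<in> E) \<or> (\<forall>s\<in>S. \<forall>v. v \<notin> S \<longrightarrow> (s, v) \<notin> E)"
    and c: "partial_coloring S L b c"
  shows "separated E (insert u S)"
    and "\<exists>c'. partial_coloring (insert u S) L b c' \<and> (\<forall>v\<in>S. c' v = c v)"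
proof -
  have one: "s = t" if "s \<in> S" "t \<in> S" "(s, u) \<in> E" "(u, t) \<in> E" for s t
  proof -
    have "steps (s # [u] @ [t]) \<subseteq> E" using that by simp
    then show ?thesis
      using sep[unfolded separated_def, rule_format, of s t "[u]"] that \<open>u \<notin> S\<close> by auto
  qed
  \<comment> \<open>The last edge of such a path leaves \<open>S\<close>, so \<open>adj\<close>
    yields a neighbour \<open>s\<close> of \<open>u\<close> in \<open>S\<close>. Prefixing
    \<open>s\<close> gives a cycle meeting \<open>S\<close> only in \<open>s\<close>, or a path
    contradicting \<open>separated E S\<close>.\<close>
  have path: False if zs: "y \<in> S" "zs \<noteq> []" "distinct zs" "set zs \<inter> insert u S = {}"
      "steps (u # zs @ [y]) \<subseteq> E" for y zs
  proof -
    obtain ws w where ws: "zs = ws @ [w]" using zs(2) by (metis rev_exhaust)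
    have "(w, y) \<in> E" using zs(5) steps_append[of "u # ws" w "[y]"] unfolding ws by simp
    then have "(y, w) \<in> E" using sym by (auto simp: sym_def)
    moreover have "w \<notin> S" using zs(4) unfolding ws by auto
    ultimately obtain s where s: "s \<in> S" "(s, u) \<in> E" using adj zs(1) by blast
    have st: "steps (s # (u # zs) @ [y]) \<subseteq> E" using s zs(5) by simp
    show False
    proof (cases "s = y")
      case True
      have "vertex_cycle E (s # u # zs)"
        using st True zs s \<open>u \<notin> S\<close> unfolding vertex_cycle_def by (cases zs) auto
      then show False using nocyc[of s "u # zs"] s zs \<open>u \<notin> S\<close> by auto
    next
      case False
      have "distinct (u # zs)" "set (u # zs) \<inter> S = {}" using zs \<open>u \<notin> S\<close> by auto
      then show False using False sep s zs(1) st unfolding separated_def by blast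
    qed
  qed
  show "separated E (insert u S)"
    unfolding separated_def
  proof (intro ballI allI impI notI)
    fix x y zs
    assume xy: "x \<in> insert u S" "y \<in> insert u S"
      and zs: "x \<noteq> y \<and> zs \<noteq> [] \<and> distinct zs \<and> set zs \<inter> insert u S = {}"
      and st: "steps (x # zs @ [y]) \<subseteq> E"
    have st': "steps (y # rev zs @ [x]) \<subseteq> E" using steps_rev_subset[OF st] by simp
    consider "x = u" "y \<in> S" | "y = u" "x \<in> S" | "x \<in> S" "y \<in> S" using xy zs by auto
    then show False
    proof cases
      case 1
      then show False using path[of y zs] zs st by auto
    next
      case 2
      then show False using path[of x "rev zs"] zs st' by auto
    next
      case 3
      then show False using sep zs st unfolding separated_def by blast
    qed
  qed
  obtain B where B: "B \<subseteq> L u" "card B = b" "\<And>s. s \<in> S \<Longrightarrow> (s, u) \<in> E \<Longrightarrow> B \<inter> c s = {}"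
  proof (cases "\<exists>s\<in>S. (s, u) \<in> E")
    case True
    then obtain s where s: "s \<in> S" "(s, u) \<in> E" by auto
    have "finite (c s)" "card (c s) = b"
      using c s L unfolding partial_coloring_def by (auto intro: finite_subset)
    then have "b \<le> card (L u - c s)"
      using diff_card_le_card_Diff[of "c s" "L u"] L ab by simp
    then obtain B where "B \<subseteq> L u - c s" "card B = b" by (meson obtain_subset_with_card_n)
    moreover have "t = s" if "t \<in> S" "(t, u) \<in> E" for t
      using one[OF that(1) s(1) that(2)] s(2) sym by (auto simp: sym_def)
    ultimately show ?thesis by (intro that[of B]) auto
  next
    case False
    have "b \<le> card (L u)" using L ab by simp
    then obtain B where "B \<subseteq> L u" "card B = b" by (meson obtain_subset_with_card_n)
    then show ?thesis using False by (intro that[of B]) auto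
  qed
  have irr: "(u, u) \<notin> E" using irrefl by (auto simp: irrefl_def)
  have "partial_coloring (insert u S) L b (c(u := B))"
    using c B irr \<open>u \<notin> S\<close> sym unfolding partial_coloring_def sym_def
    by (auto simp: Int_commute)
  then show "\<exists>c'. partial_coloring (insert u S) L b c' \<and> (\<forall>v\<in>S. c' v = c v)"
    using \<open>u \<notin> S\<close> by (intro exI[of _ "c(u := B)"]) auto
qed

lemma extend_coloring:
  fixes L c :: "'a \<Rightarrow> 'c set"
  assumes "finite V" "E \<subseteq> V \<times> V" "2 * b \<le> a"
    and L: "\<And>u. u \<in> V \<Longrightarrow> finite (L u) \<and> card (L u) = a"
    and long: "\<And>xs. vertex_cycle E xs \<Longrightarrow> b \<le> length xs div 2 * (a - 2 * b)"
    and "S \<subseteq> V" "separated E S" "partial_coloring S L b c"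
  shows "\<exists>c'. partial_coloring V L b c' \<and> (\<forall>v\<in>S. c' v = c v)"
  using assms(6-8)
proof (induction "card (V - S)" arbitrary: S c rule: less_induct)
  case less
  have step: ?case if "S \<subset> S'" "S' \<subseteq> V" "separated E S'" "partial_coloring S' L b c'"
    "\<forall>v\<in>S. c' v = c v" for S' c'
  proof -
    have "card (V - S') < card (V - S)"
      using that \<open>finite V\<close> by (intro psubset_card_mono) auto
    then show ?thesis using less.hyps[of S' c'] that by (metis psubsetE subsetD)
  qed
  \<comment> \<open>Cycles meeting \<open>S\<close> in one vertex take precedence, since adding a
    single vertex presupposes that there are none. That vertex is the head of an edge leaving
    \<open>S\<close> if there is one, and arbitrary otherwise.\<close>
  consider "S = V" | s us where "s \<in> S" "set us \<inter> S = {}" "vertex_cycle E (s # us)"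
    | u where "u \<in> V" "u \<notin> S" "\<And>s us. s \<in> S \<Longrightarrow> set us \<inter> S = {} \<Longrightarrow> \<not> vertex_cycle E (s # us)"
      "(\<exists>s\<in>S. (s, u) \<in> E) \<or> (\<forall>s\<in>S. \<forall>v. v \<notin> S \<longrightarrow> (s, v) \<notin> E)"
  proof (cases "S = V \<or> (\<exists>s\<in>S. \<exists>us. set us \<inter> S = {} \<and> vertex_cycle E (s # us))")
    case True
    then show ?thesis using that(1,2) by blast
  next
    case False
    then obtain w where w: "w \<in> V" "w \<notin> S" using less.prems(1) by blast
    show ?thesis
    proof (cases "\<exists>s\<in>S. \<exists>v. v \<notin> S \<and> (s, v) \<in> E")
      case True
      then obtain s v where "s \<in> S" "v \<notin> S" "(s, v) \<in> E" by blast
      then show ?thesis using that(3)[of v] False \<open>E \<subseteq> V \<times> V\<close> by blast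
    next
      case nonadj: False
      then show ?thesis using that(3)[of w] False w by blast
    qed
  qed
  then show ?case
  proof cases
    case 1
    then show ?thesis using less.prems by auto
  next
    case 2
    have "us \<noteq> []" using 2(3) unfolding vertex_cycle_def by auto
    have usV: "set us \<subseteq> V"
    proof
      fix x assume "x \<in> set us"
      then obtain as bs where ab: "us = as @ x # bs" by (meson split_list)
      have "steps (x # bs @ [s]) \<subseteq> E"
        using 2(3) steps_append[of "s # as" x "bs @ [s]"] unfolding vertex_cycle_def ab by simp
      then show "x \<in> V" using \<open>E \<subseteq> V \<times> V\<close> by (cases bs) auto
    qed
    then have "\<exists>c'. partial_coloring (S \<union> set us) L b c' \<and> (\<forall>u\<in>S. c' u = c u)"
      using L less.prems by (intro extend_coloring_cycle[OF \<open>2 * b \<le> a\<close> _ _ 2(1,3,2) long[OF 2(3)]]) auto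
    moreover have "S \<subset> S \<union> set us" using 2(2) \<open>us \<noteq> []\<close> by (cases us) auto
    ultimately show ?thesis
      using step[of "S \<union> set us"] separated_add_cycle(1)[OF less.prems(2) 2(1,3,2)] usV less.prems by blast
  next
    case 3
    have Lu: "finite (L u)" "card (L u) = a" "\<And>v. v \<in> S \<Longrightarrow> finite (L v)" using L 3(1) less.prems by auto
    note ext = extend_coloring_vertex[OF \<open>2 * b \<le> a\<close> Lu 3(2) less.prems(2) 3(3,4) less.prems(3)]
    obtain c' where "partial_coloring (insert u S) L b c'" "\<forall>v\<in>S. c' v = c v" using ext(2) by blast
    then show ?thesis using step[of "insert u S" c'] ext(1) 3(1,2) less.prems by blast
  qed
qed

end

section \<open>From vertex lists to arc walks\<close>

lemma steps_eq_zip: "steps xs = set (zip xs (tl xs))"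
  by (induction xs rule: steps.induct) auto

lemma awalk_of_vertices:
  fixes G :: "'a pair_pre_digraph"
  assumes "xs \<noteq> []"
  shows "pre_digraph.cas (with_proj G) (hd xs) (zip xs (tl xs)) (last xs)"
    and "pre_digraph.awalk_verts (with_proj G) (hd xs) (zip xs (tl xs)) = xs"
  using assms by (induction xs rule: induct_list012)
    (simp_all add: pre_digraph.cas.simps pre_digraph.awalk_verts.simps)

text \<open>Transfers both the disjointness of cycles and the girth bound to vertex lists.\<close>

lemma graph_cycle_of_vertices:
  fixes G :: "'a pair_pre_digraph"
  assumes "pair_graph G" "vertex_cycle (parcs G) xs"
  defines "p \<equiv> zip (xs @ [hd xs]) (tl (xs @ [hd xs]))"
  shows "graph_cycle G p" "length p = length xs" "cycle_verts p = set xs"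
    "cycle_edges p = vertex_cycle_edges xs"
proof -
  interpret pair_graph G by fact
  have xs: "distinct xs" "3 \<le> length xs" "steps (xs @ [hd xs]) \<subseteq> parcs G"
    using assms(2) unfolding vertex_cycle_def by auto
  then have ne: "xs \<noteq> []" by auto
  show len: "length p = length xs" unfolding p_def using ne by simp
  have setp: "set p = steps (xs @ [hd xs])" unfolding p_def by (simp add: steps_eq_zip)
  show "cycle_edges p = vertex_cycle_edges xs"
    unfolding cycle_edges_def vertex_cycle_edges_def setp ..
  have "map fst p = xs" unfolding p_def using ne by (simp add: map_fst_zip_take)
  then show "cycle_verts p = set xs" unfolding cycle_verts_def by (metis set_map)
  have cas: "cas (hd xs) p (hd xs)" and verts: "awalk_verts (hd xs) p = xs @ [hd xs]"
    using awalk_of_vertices[of "xs @ [hd xs]" G] ne unfolding p_def by auto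
  have "hd xs \<in> pverts G"
  proof -
    obtain x y ys where "xs = x # y # ys" using xs(2) by (cases xs; cases "tl xs") auto
    then show ?thesis using xs(3) by (auto dest: in_arcsD1)
  qed
  then have "awalk (hd xs) p (hd xs)" unfolding awalk_def using cas setp xs(3) by auto
  moreover have "distinct (tl (awalk_verts (hd xs) p))"
    unfolding verts using xs(1) ne by (cases xs) auto
  ultimately have "cycle p" unfolding cycle_def using len ne by auto
  then show "graph_cycle G p" unfolding graph_cycle_def using len xs(2) by simp
qed

section \<open>The threshold in terms of the girth\<close>

theorem corollary10:
  fixes G :: "'a pair_pre_digraph" and g :: nat
  assumes "tree_of_cycles G" and "girth G = enat g"
  shows "G \<in> FCH (2 + inverse (of_int \<lfloor>real g / 2\<rfloor>))"
proof -
  have G: "pair_graph G" "disjoint_cycles G" using assms(1) unfolding tree_of_cycles_def by auto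
  interpret pair_graph G by fact
  interpret C: disjoint_vertex_cycles "parcs G"
  proof
    show "sym (parcs G)" using sym_arcs unfolding symmetric_def by simp
    show "irrefl (parcs G)" using no_loops by (fastforce simp: irrefl_def)
    fix xs ys
    assume "vertex_cycle (parcs G) xs" "vertex_cycle (parcs G) ys" "set xs \<inter> set ys \<noteq> {}"
    then show "vertex_cycle_edges xs = vertex_cycle_edges ys"
      using G(2) graph_cycle_of_vertices[OF G(1)] unfolding disjoint_cycles_def by metis
  qed
  have girth_le: "g \<le> length p" if "graph_cycle G p" for p
  proof -
    have "girth G \<le> enat (length p)" unfolding girth_def using that by (intro INF_lower) auto
    then show ?thesis using assms(2) by simp
  qed
  \<comment> \<open>Keeps \<open>g div 2\<close> positive, so that \<open>inverse\<close> is a true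
    reciprocal and not the default value at 0.\<close>
  have "3 \<le> g"
  proof -
    have "enat 3 \<le> girth G" unfolding girth_def by (intro INF_greatest) (auto simp: graph_cycle_def)
    then show ?thesis using assms(2) by simp
  qed
  have fl: "\<lfloor>real g / 2\<rfloor> = int (g div 2)" by (metis floor_divide_of_nat_eq of_nat_numeral)
  show ?thesis unfolding FCH_def mem_Collect_eq
  proof (intro conjI allI impI)
    show "pair_graph G" by fact
    fix a b :: nat
    assume asm: "1 \<le> b \<and> b \<le> a \<and> 2 + inverse (of_int \<lfloor>real g / 2\<rfloor>) \<le> real a / real b"
    define k where "k = g div 2"
    have k: "1 \<le> k" using \<open>3 \<le> g\<close> unfolding k_def by simp
    have "(2 + inverse (real k)) * real b \<le> real a"
      using asm unfolding fl k_def[symmetric] by (simp add: le_divide_eq)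
    \<comment> \<open>Clearing denominators turns the ratio condition into
      \<open>b \<le> k * (a - 2 * b)\<close>.\<close>
    then have ineq: "real k * (2 * real b) + real b \<le> real k * real a"
      using k mult_left_mono[of "(2 + inverse (real k)) * real b" "real a" "real k"]
      by (simp add: algebra_simps)
    then have "k * (2 * b) + b \<le> k * a"
      by (metis (mono_tags) of_nat_add of_nat_le_iff of_nat_mult of_nat_numeral)
    then have kb: "b \<le> k * (a - 2 * b)" by (simp add: diff_mult_distrib2)
    \<comment> \<open>If \<open>a < 2 * b\<close>, the truncated difference in \<open>kb\<close>
      would be 0, contradicting \<open>1 \<le> b\<close>.\<close>
    then have ab: "2 * b \<le> a" using asm by (cases "2 * b \<le> a") auto
    show "free_choosable a b G" unfolding free_choosable_def
    proof (intro allI impI)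
      fix L v c0
      assume h: "color_list G a L \<and> v \<in> pverts G \<and> c0 \<subseteq> L v \<and> card c0 = b"
      \<comment> \<open>The extension starts from \<open>v\<close> alone and never changes colours
        already given, so \<open>c0\<close> survives at \<open>v\<close>.\<close>
      have "separated (parcs G) {v}" unfolding separated_def by auto
      moreover have "C.partial_coloring {v} L b (\<lambda>_. c0)"
        using h C.irrefl unfolding C.partial_coloring_def irrefl_def by auto
      moreover have "b \<le> length xs div 2 * (a - 2 * b)" if "vertex_cycle (parcs G) xs" for xs
      proof -
        have "g \<le> length xs" using girth_le graph_cycle_of_vertices(1,2)[OF G(1) that] by metis
        then have "k * (a - 2 * b) \<le> length xs div 2 * (a - 2 * b)"
          unfolding k_def by (intro mult_le_mono1 div_le_mono)
        with kb show ?thesis by (rule order_trans)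
      qed
      moreover have arcs: "parcs G \<subseteq> pverts G \<times> pverts G" using in_arcsD1 in_arcsD2 by auto
      ultimately obtain c where "C.partial_coloring (pverts G) L b c" "c v = c0"
        using C.extend_coloring[of "pverts G" b a L "{v}" "\<lambda>_. c0"] ab h unfolding color_list_def by auto
      then show "\<exists>c. list_coloring G L b c \<and> c v = c0"
        using arcs unfolding list_coloring_def C.partial_coloring_def
        by (intro exI[of _ c]) fast
    qed
  qed
qed

end
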